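(* Let $n\ge 1$ be an integer, $\kappa>0$, let $C\subseteq \mathbb{H}^n_\kappa$ be a closed $\kappa$-hyperbolically convex set, let $p\in\mathbb{H}^n_\kappa$ and let $u\in\Lambda_{K_C}(p)\setminus\{0\}$. Then $$P^\kappa_C(p)=\frac{u}{\sqrt{-\kappa\langle u,u\rangle}}.$$
   Context: For $x,y\in\mathbb{R}^{n+1}$ the Lorentzian inner product is $\langle x,y\rangle:=x_1y_1+\dots+x_ny_n-x_{n+1}y_{n+1}$. The $\kappa$-hyperbolic space form is $\mathbb{H}^n_\kappa:=\{p\in\mathbb{R}^{n+1}:\langle p,p\rangle=-1/\kappa,\ p_{n+1}>0\}$, with intrinsic distance $d_\kappa(p,q):=\frac{1}{\sqrt\kappa}\operatorname{arcosh}(-\kappa\langle p,q\rangle)$. It is a Riemannian manifold with the metric induced by $\langle\cdot,\cdot\rangle$ on tangent spaces; any two distinct points are joined by a unique geodesic segment, and a set $C\subseteq\mathbb{H}^n_\kappa$ is called $\kappa$-hyperbolically convex if for all $p,q\in C$ the geodesic segment joining $p$ to $q$ is contained in $C$. For a nonempty closed $\kappa$-hyperbolically convex set $C$, the intrinsic $\kappa$-projection $P^\kappa_C(p)$ of $p\in\mathbb{H}^n_\kappa$ is the unique minimizer of $q\mapsto d_\kappa(p,q)$ over $q\in C$. The cone spanned by $C$ is $K_C:=\{tp: p\in C,\ t\in[0,+\infty)\}$; it is a convex cone when $C$ is $\kappa$-hyperbolically convex. For a convex set $K\subseteq\mathbb{R}^{n+1}$ and $x\in\mathbb{R}^{n+1}$,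 the set of Lorentz projections (L-projections) of $x$ into $K$ is $\Lambda_K(x):=\{y\in K:\langle x-y,z-y\rangle\le 0\ \text{for all } z\in K\}$. *)

theory Defs
  imports "HOL-Analysis.Analysis"
begin

text \<open>
  The space of dimension \<open>n + 1\<close> is represented as \<open>(real ^ 'n) \<times> real\<close> with \<open>n = CARD('n)\<close>;
  the second component is the last (time-like) coordinate.
\<close>

definition lorentz :: "(real ^ 'n::finite) \<times> real \<Rightarrow> (real ^ 'n) \<times> real \<Rightarrow> real" where
  "lorentz x y = (\<Sum>i\<in>UNIV. fst x $ i * fst y $ i) - snd x * snd y"

definition hyperbolic_space :: "real \<Rightarrow> ((real ^ 'n::finite) \<times> real) set" where
  "hyperbolic_space \<kappa> = {p. lorentz p p = - 1 / \<kappa> \<and> snd p > 0}"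

definition hyperbolic_dist ::
    "real \<Rightarrow> (real ^ 'n::finite) \<times> real \<Rightarrow> (real ^ 'n) \<times> real \<Rightarrow> real" where
  "hyperbolic_dist \<kappa> p q = 1 / sqrt \<kappa> * arcosh (- \<kappa> * lorentz p q)"

definition hyperbolic_tangent :: "(real ^ 'n::finite) \<times> real \<Rightarrow> ((real ^ 'n) \<times> real) set" where
  "hyperbolic_tangent p = {v. lorentz p v = 0}"

text \<open>
  The Levi-Civita connection of the induced metric is the Lorentz-orthogonal projection of the
  ambient derivative onto the tangent space.  So a curve in the space form is a geodesic iff its
  acceleration is Lorentz-orthogonal to the tangent space at each point.  Solutions of this
  equation are automatically smooth, so twice differentiable curves suffice; constant curves
  are included.
\<close>

definition hyperbolic_geodesic :: "real \<Rightarrow> (real \<Rightarrow> (real ^ 'n::finite) \<times> real) \<Rightarrow> bool" where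
  "hyperbolic_geodesic \<kappa> \<gamma> \<longleftrightarrow>
     (\<forall>t\<in>{0..1}. \<gamma> t \<in> hyperbolic_space \<kappa>) \<and>
     (\<exists>\<gamma>' \<gamma>''. \<forall>t\<in>{0..1}.
        (\<gamma> has_vector_derivative \<gamma>' t) (at t within {0..1}) \<and>
        (\<gamma>' has_vector_derivative \<gamma>'' t) (at t within {0..1}) \<and>
        (\<forall>v\<in>hyperbolic_tangent (\<gamma> t). lorentz (\<gamma>'' t) v = 0))"

definition geodesic_segment_between ::
    "real \<Rightarrow> (real ^ 'n::finite) \<times> real \<Rightarrow> (real ^ 'n) \<times> real \<Rightarrow> ((real ^ 'n) \<times> real) set \<Rightarrow> bool"
  where
  "geodesic_segment_between \<kappa> p q S \<longleftrightarrow>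
     (\<exists>\<gamma>. hyperbolic_geodesic \<kappa> \<gamma> \<and> \<gamma> 0 = p \<and> \<gamma> 1 = q \<and> S = \<gamma> ` {0..1})"

text \<open>
  For \<open>\<kappa> > 0\<close> there is exactly one segment between two points of the space form, so the
  quantification over segments below is over precisely one set.
\<close>

definition hyperbolically_convex :: "real \<Rightarrow> ((real ^ 'n::finite) \<times> real) set \<Rightarrow> bool" where
  "hyperbolically_convex \<kappa> C \<longleftrightarrow>
     C \<subseteq> hyperbolic_space \<kappa> \<and>
     (\<forall>p\<in>C. \<forall>q\<in>C. \<forall>S. geodesic_segment_between \<kappa> p q S \<longrightarrow> S \<subseteq> C)"

definition hyperbolic_projection ::
    "real \<Rightarrow> ((real ^ 'n::finite) \<times> real) set \<Rightarrow> (real ^ 'n) \<times> real \<Rightarrow> (real ^ 'n) \<times> real" where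
  "hyperbolic_projection \<kappa> C p =
     (THE q. q \<in> C \<and> (\<forall>r\<in>C. hyperbolic_dist \<kappa> p q \<le> hyperbolic_dist \<kappa> p r))"

definition spanned_cone :: "((real ^ 'n::finite) \<times> real) set \<Rightarrow> ((real ^ 'n) \<times> real) set" where
  "spanned_cone C = {t *\<^sub>R p | t p. p \<in> C \<and> 0 \<le> t}"

definition lorentz_projections ::
    "((real ^ 'n::finite) \<times> real) set \<Rightarrow> (real ^ 'n) \<times> real \<Rightarrow> ((real ^ 'n) \<times> real) set" where
  "lorentz_projections K x = {y \<in> K. \<forall>z\<in>K. lorentz (x - y) (z - y) \<le> 0}"

end

theory Submission
  imports Defs
begin

text \<open>
  On the cone \<open>K\<^sub>C\<close>, the condition \<open>u \<in> \<Lambda>(p)\<close> amounts to \<open>\<langle>p, u\<rangle> = \<langle>u, u\<rangle>\<close> and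
  \<open>\<langle>p, z\<rangle> \<le> \<langle>u, z\<rangle>\<close> for all \<open>z\<close> in the cone. Write \<open>u = t q\<close> with \<open>q \<in> C\<close> and \<open>t > 0\<close>. The reverse
  Cauchy-Schwarz inequality \<open>\<langle>q, r\<rangle> \<le> -1/\<kappa> = \<langle>q, q\<rangle>\<close> then gives
  \<open>\<langle>p, r\<rangle> \<le> t \<langle>q, r\<rangle> \<le> t \<langle>q, q\<rangle> = \<langle>p, q\<rangle>\<close> for \<open>r \<in> C\<close>, so \<open>q\<close> is a nearest point to \<open>p\<close>, and
  the equality case of the same inequality shows that it is the only one.
\<close>

lemma lorentz_eq_inner: "lorentz x y = fst x \<bullet> fst y - snd x * snd y"
  by (simp add: lorentz_def inner_vec_def)

lemma lorentz_diff_left: "lorentz (x - y) z = lorentz x z - lorentz y z"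
  by (simp add: lorentz_eq_inner algebra_simps)

lemma lorentz_diff_right: "lorentz x (y - z) = lorentz x y - lorentz x z"
  by (simp add: lorentz_eq_inner algebra_simps)

lemma lorentz_minus_right: "lorentz x (- y) = - lorentz x y"
  by (simp add: lorentz_eq_inner)

lemma lorentz_scaleR_left: "lorentz (a *\<^sub>R x) y = a * lorentz x y"
  by (simp add: lorentz_eq_inner algebra_simps)

lemma lorentz_scaleR_right: "lorentz x (a *\<^sub>R y) = a * lorentz x y"
  by (simp add: lorentz_eq_inner algebra_simps)

text \<open>Reverse Cauchy-Schwarz: the time coordinates are fixed by the space parts, so the
  ordinary Cauchy-Schwarz inequality for the latter controls both the bound and its equality
  case.\<close>

lemma lorentz_le_on_hyperbolic_space:
  assumes "\<kappa> > 0" "q \<in> hyperbolic_space \<kappa>" "r \<in> hyperbolic_space \<kappa>"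
  shows "lorentz q r \<le> - 1 / \<kappa>"
    and "lorentz q r = - 1 / \<kappa> \<Longrightarrow> q = r"
proof -
  define c where "c = 1 / \<kappa>"
  have c: "c > 0" using assms(1) by (simp add: c_def)
  have q: "(snd q)\<^sup>2 = fst q \<bullet> fst q + c" "snd q > 0"
    and r: "(snd r)\<^sup>2 = fst r \<bullet> fst r + c" "snd r > 0"
    using assms(2,3) by (auto simp: hyperbolic_space_def lorentz_eq_inner c_def power2_eq_square)
  have "(snd q * snd r)\<^sup>2 = (fst q \<bullet> fst q + c) * (fst r \<bullet> fst r + c)"
    by (simp add: power_mult_distrib q r)
  \<comment> \<open>The excess over the square is \<open>c\<close> times the squared distance of the
    space parts plus their Gram determinant. Both are nonnegative, and equality forces the distance
    to vanish.\<close>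
  also have "\<dots> = (fst q \<bullet> fst r + c)\<^sup>2 + c * ((fst q - fst r) \<bullet> (fst q - fst r))
      + ((fst q \<bullet> fst q) * (fst r \<bullet> fst r) - (fst q \<bullet> fst r)\<^sup>2)"
    by (simp add: power2_eq_square algebra_simps inner_commute)
  finally have gap: "(snd q * snd r)\<^sup>2 \<ge>
      (fst q \<bullet> fst r + c)\<^sup>2 + c * ((fst q - fst r) \<bullet> (fst q - fst r))"
    using Cauchy_Schwarz_ineq[of "fst q" "fst r"] by linarith
  have "(fst q \<bullet> fst r + c)\<^sup>2 \<le> (snd q * snd r)\<^sup>2"
    using gap c by (smt (verit) inner_ge_zero mult_nonneg_nonneg)
  then have "fst q \<bullet> fst r + c \<le> snd q * snd r"
    by (rule power2_le_imp_le) (use q(2) r(2) in simp)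
  then show "lorentz q r \<le> - 1 / \<kappa>"
    by (simp add: lorentz_eq_inner c_def)
  assume "lorentz q r = - 1 / \<kappa>"
  then have "fst q \<bullet> fst r + c = snd q * snd r"
    by (simp add: lorentz_eq_inner c_def)
  then have "c * ((fst q - fst r) \<bullet> (fst q - fst r)) \<le> 0"
    using gap by simp
  then have "(fst q - fst r) \<bullet> (fst q - fst r) \<le> 0"
    using c by (simp add: mult_le_0_iff)
  then have "fst q = fst r"
    using inner_gt_zero_iff[of "fst q - fst r"] by (simp add: not_less[symmetric])
  moreover from this have "snd q = snd r"
    using q r by (metis less_imp_le power2_eq_imp_eq)
  ultimately show "q = r" by (simp add: prod_eq_iff)
qed

text \<open>\<open>arcosh\<close> is strictly increasing on [1, \<infinity>), where reverse
  Cauchy-Schwarz places its arguments; the factor \<open>- \<kappa>\<close> reverses the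
  order.\<close>

lemma hyperbolic_dist_le_iff:
  assumes "\<kappa> > 0" "p \<in> hyperbolic_space \<kappa>" "q \<in> hyperbolic_space \<kappa>" "r \<in> hyperbolic_space \<kappa>"
  shows "hyperbolic_dist \<kappa> p q \<le> hyperbolic_dist \<kappa> p r \<longleftrightarrow> lorentz p r \<le> lorentz p q"
proof -
  have ge1: "- \<kappa> * lorentz p s \<ge> 1" if "s \<in> hyperbolic_space \<kappa>" for s
    using lorentz_le_on_hyperbolic_space(1)[OF assms(1,2) that] assms(1)
    by (simp add: field_simps)
  have "hyperbolic_dist \<kappa> p q \<le> hyperbolic_dist \<kappa> p r \<longleftrightarrow>
      arcosh (- \<kappa> * lorentz p q) \<le> arcosh (- \<kappa> * lorentz p r)"
    using assms(1) by (simp add: hyperbolic_dist_def divide_le_cancel)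
  also have "\<dots> \<longleftrightarrow> - \<kappa> * lorentz p q \<le> - \<kappa> * lorentz p r"
    using ge1[OF assms(3)] ge1[OF assms(4)] arcosh_less_iff_real
    by (meson linorder_not_less)
  finally show ?thesis using assms(1) by simp
qed

lemma lorentz_projection_cone:
  assumes "u \<in> lorentz_projections (spanned_cone C) p"
  shows "lorentz p u = lorentz u u"
    and "z \<in> spanned_cone C \<Longrightarrow> lorentz p z \<le> lorentz u z"
proof -
  have le: "lorentz (p - u) (z - u) \<le> 0" if "z \<in> spanned_cone C" for z
    using assms that by (simp add: lorentz_projections_def)
  obtain t q where u: "u = t *\<^sub>R q" "q \<in> C" "t \<ge> 0"
    using assms by (auto simp: lorentz_projections_def spanned_cone_def)
  have mem: "s *\<^sub>R u \<in> spanned_cone C" if "s \<ge> 0" for s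
  proof -
    have "s *\<^sub>R u = (s * t) *\<^sub>R q" "0 \<le> s * t"
      using u that by simp_all
    then show ?thesis
      using u(2) unfolding spanned_cone_def by blast
  qed
  show eq: "lorentz p u = lorentz u u"
    \<comment> \<open>Testing with 0 and \<open>2 *\<^sub>R u\<close> bounds
      \<open>lorentz (p - u) u\<close> from below and from above by 0.\<close>
    using le[OF mem[of 0]] le[OF mem[of 2]]
    by (simp add: lorentz_diff_left lorentz_diff_right lorentz_minus_right lorentz_scaleR_right)
  show "lorentz p z \<le> lorentz u z" if "z \<in> spanned_cone C"
    using le[OF that] eq by (simp add: lorentz_diff_left lorentz_diff_right)
qed

theorem theorem13:
  fixes \<kappa> :: real
    and C :: "((real ^ 'n::finite) \<times> real) set"
    and p u :: "(real ^ 'n) \<times> real"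
  assumes "\<kappa> > 0"
    and "closedin (top_of_set (hyperbolic_space \<kappa>)) C"
    and "hyperbolically_convex \<kappa> C"
    and "p \<in> hyperbolic_space \<kappa>"
    and "u \<in> lorentz_projections (spanned_cone C) p - {0}"
  shows "hyperbolic_projection \<kappa> C p = u /\<^sub>R sqrt (- \<kappa> * lorentz u u)"
proof -
  note hyp = lorentz_le_on_hyperbolic_space[OF assms(1)]
  have C: "r \<in> hyperbolic_space \<kappa>" if "r \<in> C" for r
    using assms(3) that by (auto simp: hyperbolically_convex_def)
  have uL: "u \<in> lorentz_projections (spanned_cone C) p" and "u \<noteq> 0"
    using assms(5) by auto
  then obtain t q where u: "u = t *\<^sub>R q" and q: "q \<in> C" and "t \<ge> 0"
    by (auto simp: lorentz_projections_def spanned_cone_def)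
  with \<open>u \<noteq> 0\<close> have t: "t > 0"
    by (cases "t = 0") auto
  have qq: "lorentz q q = - 1 / \<kappa>"
    using C[OF q] by (simp add: hyperbolic_space_def)
  \<comment> \<open>Both sides of \<open>lorentz p u = lorentz u u\<close> carry a factor
    \<open>t\<close>, which cancels.\<close>
  have pq: "lorentz p q = t * lorentz q q"
    using lorentz_projection_cone(1)[OF uL] t
    by (simp add: u lorentz_scaleR_left lorentz_scaleR_right)
  have pr: "lorentz p r \<le> t * lorentz q r" if "r \<in> C" for r
  proof -
    have "1 *\<^sub>R r \<in> spanned_cone C"
      using that unfolding spanned_cone_def
      by (intro CollectI exI[of _ 1] exI[of _ r]) simp
    then show ?thesis
      using lorentz_projection_cone(2)[OF uL] by (fastforce simp: u lorentz_scaleR_left)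
  qed
  note dist_iff = hyperbolic_dist_le_iff[OF assms(1,4)]
  have nearest: "hyperbolic_dist \<kappa> p q \<le> hyperbolic_dist \<kappa> p r" if "r \<in> C" for r
  proof -
    have "t * lorentz q r \<le> lorentz p q"
      unfolding pq qq using hyp(1)[OF C[OF q] C[OF that]] t by (intro mult_left_mono) auto
    then show ?thesis
      using pr[OF that] dist_iff[OF C[OF q] C[OF that]] by linarith
  qed
  have unique: "r = q" if "r \<in> C" "hyperbolic_dist \<kappa> p r \<le> hyperbolic_dist \<kappa> p q" for r
  proof -
    \<comment> \<open>The left side is \<open>lorentz p q\<close>, which is at most
      \<open>lorentz p r\<close> when \<open>r\<close> is no farther from \<open>p\<close> than
      \<open>q\<close>. Cancelling \<open>t\<close> leads to the equality case.\<close>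
    have "t * (- 1 / \<kappa>) \<le> t * lorentz q r"
      using that(2) pr[OF that(1)] dist_iff[OF C[OF that(1)] C[OF q]] pq qq by simp
    then have "- 1 / \<kappa> \<le> lorentz q r"
      using t by (simp only: mult_le_cancel_left_pos)
    then show ?thesis
      using hyp[OF C[OF q] C[OF that(1)]] by (metis order.antisym)
  qed
  have "hyperbolic_projection \<kappa> C p = q"
    unfolding hyperbolic_projection_def using q nearest unique by (intro the_equality) auto
  \<comment> \<open>Hence the normalizing square root is \<open>t\<close>, and rescaling
    \<open>u\<close> recovers \<open>q\<close>.\<close>
  moreover have "- \<kappa> * lorentz u u = t\<^sup>2"
    using assms(1) by (simp add: u lorentz_scaleR_left lorentz_scaleR_right qq power2_eq_square)
  ultimately show ?thesis
    using t by (simp add: u)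
qed

end
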